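(* If $K$ is an algebraically closed field and $C$ is an infinite dimensional chain coalgebra over $K$, then $C$ is isomorphic (as a coalgebra) to the divided power coalgebra over $K$.
   Context: A coalgebra $C$ over a field $K$ is a chain coalgebra if any two left subcomodules of $C$ are comparable under inclusion (this is equivalent to the same condition for right subcomodules). The divided power coalgebra over $K$ is the coalgebra with basis $(c_n)_{n\in\mathbb{N}}$, $\mathbb{N}=\{0,1,2,\dots\}$, comultiplication $\Delta(c_n)=\sum_{i+j=n}c_i\otimes c_j$ and counit $\varepsilon(c_n)=\delta_{0,n}$. *)

theory Defs
  imports "HOL-Library.Poly_Mapping" "HOL-Computational_Algebra.Computational_Algebra"
begin

section \<open>Free vector spaces\<close>

text \<open>
  The type \<open>'a \<Rightarrow>\<^sub>0 'k\<close> of finitely supported functions is the free vector space over the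
  field \<open>'k\<close> on the basis \<open>'a\<close>; the basis vector at \<open>a\<close> is \<open>Poly_Mapping.single a 1\<close>.
\<close>

definition fscale :: "'k::field \<Rightarrow> ('a \<Rightarrow>\<^sub>0 'k) \<Rightarrow> ('a \<Rightarrow>\<^sub>0 'k)" where
  "fscale c p = Poly_Mapping.map ((*) c) p"

definition basis_vec :: "'a \<Rightarrow> ('a \<Rightarrow>\<^sub>0 'k::field)" where
  "basis_vec a = Poly_Mapping.single a 1"

text \<open>The linear extension of a map defined on basis elements.\<close>

definition linext :: "('k::field \<Rightarrow> 'v::ab_group_add \<Rightarrow> 'v) \<Rightarrow> ('a \<Rightarrow> 'v) \<Rightarrow> ('a \<Rightarrow>\<^sub>0 'k) \<Rightarrow> 'v" where
  "linext s f p = (\<Sum>a\<in>Poly_Mapping.keys p. s (Poly_Mapping.lookup p a) (f a))"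

definition push :: "('a \<Rightarrow> 'b) \<Rightarrow> ('a \<Rightarrow>\<^sub>0 'k::field) \<Rightarrow> ('b \<Rightarrow>\<^sub>0 'k)" where
  "push f p = linext fscale (\<lambda>a. basis_vec (f a)) p"

lemma lookup_fscale [simp]: "Poly_Mapping.lookup (fscale c p) x = c * Poly_Mapping.lookup p x"
  by (simp add: fscale_def Poly_Mapping.map.rep_eq when_def)

interpretation free: vector_space "fscale :: 'k::field \<Rightarrow> ('a \<Rightarrow>\<^sub>0 'k) \<Rightarrow> ('a \<Rightarrow>\<^sub>0 'k)"
  by unfold_locales (auto intro!: poly_mapping_eqI simp: lookup_add algebra_simps)


section \<open>Tensor powers\<close>

text \<open>
  The tensor products \<open>V \<otimes> V\<close> and \<open>V \<otimes> V \<otimes> V\<close> are constructed as quotients of the free vector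
  spaces on \<open>V \<times> V\<close> and \<open>V \<times> V \<times> V\<close>, and their elements are the cosets of the subspaces of
  relations. Here \<open>V\<close> is the type \<open>'v\<close> with scalar multiplication \<open>s\<close>. The set
  \<open>slot_rels s g\<close> consists of the relations that make \<open>v \<mapsto> g v\<close> linear in the quotient.
\<close>

definition slot_rels ::
  "('k::field \<Rightarrow> 'v::ab_group_add \<Rightarrow> 'v) \<Rightarrow> ('v \<Rightarrow> 'a) \<Rightarrow> ('a \<Rightarrow>\<^sub>0 'k) set" where
  "slot_rels s g =
     {basis_vec (g (x + y)) - basis_vec (g x) - basis_vec (g y) | x y. True} \<union>
     {basis_vec (g (s c x)) - fscale c (basis_vec (g x)) | c x. True}"

definition tensor_rel ::
  "('k::field \<Rightarrow> 'v::ab_group_add \<Rightarrow> 'v) \<Rightarrow> ('v \<times> 'v \<Rightarrow>\<^sub>0 'k) set" where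
  "tensor_rel s = free.span
     ((\<Union>y. slot_rels s (\<lambda>x. (x, y))) \<union> (\<Union>x. slot_rels s (\<lambda>y. (x, y))))"

definition tensor3_rel ::
  "('k::field \<Rightarrow> 'v::ab_group_add \<Rightarrow> 'v) \<Rightarrow> ('v \<times> 'v \<times> 'v \<Rightarrow>\<^sub>0 'k) set" where
  "tensor3_rel s = free.span
     ((\<Union>y z. slot_rels s (\<lambda>x. (x, y, z))) \<union> (\<Union>x z. slot_rels s (\<lambda>y. (x, y, z))) \<union>
      (\<Union>x y. slot_rels s (\<lambda>z. (x, y, z))))"

definition tensor_class ::
  "('k::field \<Rightarrow> 'v::ab_group_add \<Rightarrow> 'v) \<Rightarrow> ('v \<times> 'v \<Rightarrow>\<^sub>0 'k) \<Rightarrow> ('v \<times> 'v \<Rightarrow>\<^sub>0 'k) set" where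
  "tensor_class s t = {u. u - t \<in> tensor_rel s}"

definition tensor3_class ::
  "('k::field \<Rightarrow> 'v::ab_group_add \<Rightarrow> 'v) \<Rightarrow> ('v \<times> 'v \<times> 'v \<Rightarrow>\<^sub>0 'k) \<Rightarrow> ('v \<times> 'v \<times> 'v \<Rightarrow>\<^sub>0 'k) set" where
  "tensor3_class s t = {u. u - t \<in> tensor3_rel s}"

definition tensor_space ::
  "('k::field \<Rightarrow> 'v::ab_group_add \<Rightarrow> 'v) \<Rightarrow> ('v \<times> 'v \<Rightarrow>\<^sub>0 'k) set set" where
  "tensor_space s = range (tensor_class s)"

text \<open>
  Operations on cosets are defined through representatives. The union over all representatives
  makes no choice: all the classes in it coincide whenever the operation is well defined.
\<close>

definition tensor_add ::
  "('k::field \<Rightarrow> 'v::ab_group_add \<Rightarrow> 'v) \<Rightarrow>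
     ('v \<times> 'v \<Rightarrow>\<^sub>0 'k) set \<Rightarrow> ('v \<times> 'v \<Rightarrow>\<^sub>0 'k) set \<Rightarrow> ('v \<times> 'v \<Rightarrow>\<^sub>0 'k) set" where
  "tensor_add s X Y = (\<Union>t\<in>X. \<Union>u\<in>Y. tensor_class s (t + u))"

definition tensor_scale ::
  "('k::field \<Rightarrow> 'v::ab_group_add \<Rightarrow> 'v) \<Rightarrow>
     'k \<Rightarrow> ('v \<times> 'v \<Rightarrow>\<^sub>0 'k) set \<Rightarrow> ('v \<times> 'v \<Rightarrow>\<^sub>0 'k) set" where
  "tensor_scale s c X = (\<Union>t\<in>X. tensor_class s (fscale c t))"

text \<open>\<open>tensor_map s' f\<close> is \<open>f \<otimes> f : V \<otimes> V \<rightarrow> W \<otimes> W\<close>, where \<open>s'\<close> is the scalar multiplication of \<open>W\<close>.\<close>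

definition tensor_map ::
  "('k::field \<Rightarrow> 'w::ab_group_add \<Rightarrow> 'w) \<Rightarrow> ('v \<Rightarrow> 'w) \<Rightarrow>
     ('v \<times> 'v \<Rightarrow>\<^sub>0 'k) set \<Rightarrow> ('w \<times> 'w \<Rightarrow>\<^sub>0 'k) set" where
  "tensor_map s' f X = (\<Union>t\<in>X. tensor_class s' (push (map_prod f f) t))"

text \<open>
  \<open>comult_left s \<Delta>\<close> and \<open>comult_right s \<Delta>\<close> are \<open>\<Delta> \<otimes> id\<close> and \<open>id \<otimes> \<Delta>\<close>, as maps
  \<open>V \<otimes> V \<rightarrow> V \<otimes> V \<otimes> V\<close>. The function \<open>d\<close> picks a representative of each \<open>\<Delta> x\<close>.
\<close>

definition comult_left ::
  "('k::field \<Rightarrow> 'v::ab_group_add \<Rightarrow> 'v) \<Rightarrow> ('v \<Rightarrow> ('v \<times> 'v \<Rightarrow>\<^sub>0 'k) set) \<Rightarrow>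
     ('v \<times> 'v \<Rightarrow>\<^sub>0 'k) set \<Rightarrow> ('v \<times> 'v \<times> 'v \<Rightarrow>\<^sub>0 'k) set" where
  "comult_left s \<Delta> X = (\<Union>t\<in>X. \<Union>d\<in>{d. \<forall>x. d x \<in> \<Delta> x}.
     tensor3_class s (linext fscale (\<lambda>(x, y). push (\<lambda>(u, v). (u, v, y)) (d x)) t))"

definition comult_right ::
  "('k::field \<Rightarrow> 'v::ab_group_add \<Rightarrow> 'v) \<Rightarrow> ('v \<Rightarrow> ('v \<times> 'v \<Rightarrow>\<^sub>0 'k) set) \<Rightarrow>
     ('v \<times> 'v \<Rightarrow>\<^sub>0 'k) set \<Rightarrow> ('v \<times> 'v \<times> 'v \<Rightarrow>\<^sub>0 'k) set" where
  "comult_right s \<Delta> X = (\<Union>t\<in>X. \<Union>d\<in>{d. \<forall>x. d x \<in> \<Delta> x}.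
     tensor3_class s (linext fscale (\<lambda>(x, y). push (\<lambda>(u, v). (x, u, v)) (d y)) t))"


section \<open>Coalgebras\<close>

text \<open>
  In the counit laws, \<open>K \<otimes> C\<close> and \<open>C \<otimes> K\<close> are identified with \<open>C\<close> through scalar multiplication.
\<close>

locale coalgebra = vector_space scale
  for scale :: "'k::field \<Rightarrow> 'c::ab_group_add \<Rightarrow> 'c" +
  fixes comult :: "'c \<Rightarrow> ('c \<times> 'c \<Rightarrow>\<^sub>0 'k) set"
    and counit :: "'c \<Rightarrow> 'k"
  assumes comult_in_tensor_space: "comult a \<in> tensor_space scale"
    and comult_add: "comult (a + b) = tensor_add scale (comult a) (comult b)"
    and comult_scale: "comult (scale c a) = tensor_scale scale c (comult a)"
    and linear_counit: "Vector_Spaces.linear scale (*) counit"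
    and coassoc: "comult_left scale comult (comult a) = comult_right scale comult (comult a)"
    and counit_left: "t \<in> comult a \<Longrightarrow> linext scale (\<lambda>(x, y). scale (counit x) y) t = a"
    and counit_right: "t \<in> comult a \<Longrightarrow> linext scale (\<lambda>(x, y). scale (counit y) x) t = a"

text \<open>
  A left subcomodule of \<open>C\<close> is a subspace \<open>N\<close> with \<open>\<Delta>(N) \<subseteq> C \<otimes> N\<close>. Here \<open>C \<otimes> N\<close> is regarded as a
  subspace of \<open>C \<otimes> C\<close>: it consists of the classes of formal sums of pairs \<open>(x, y)\<close> with \<open>y \<in> N\<close>.
\<close>

definition tensor_right_sub ::
  "('k::field \<Rightarrow> 'v::ab_group_add \<Rightarrow> 'v) \<Rightarrow> 'v set \<Rightarrow> ('v \<times> 'v \<Rightarrow>\<^sub>0 'k) set set" where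
  "tensor_right_sub s N = tensor_class s ` {t. Poly_Mapping.keys t \<subseteq> UNIV \<times> N}"

context coalgebra
begin

definition left_subcomodule :: "'c set \<Rightarrow> bool" where
  "left_subcomodule N \<longleftrightarrow> subspace N \<and> comult ` N \<subseteq> tensor_right_sub scale N"

end

locale chain_coalgebra = coalgebra +
  assumes left_subcomodules_chain:
    "left_subcomodule M \<Longrightarrow> left_subcomodule N \<Longrightarrow> M \<subseteq> N \<or> N \<subseteq> M"

definition coalgebra_iso ::
  "('k::field \<Rightarrow> 'c::ab_group_add \<Rightarrow> 'c) \<Rightarrow> ('c \<Rightarrow> ('c \<times> 'c \<Rightarrow>\<^sub>0 'k) set) \<Rightarrow> ('c \<Rightarrow> 'k) \<Rightarrow>
   ('k \<Rightarrow> 'd::ab_group_add \<Rightarrow> 'd) \<Rightarrow> ('d \<Rightarrow> ('d \<times> 'd \<Rightarrow>\<^sub>0 'k) set) \<Rightarrow> ('d \<Rightarrow> 'k) \<Rightarrow>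
   ('c \<Rightarrow> 'd) \<Rightarrow> bool" where
  "coalgebra_iso s \<Delta> \<epsilon> s' \<Delta>' \<epsilon>' f \<longleftrightarrow>
     Vector_Spaces.linear s s' f \<and> bij f \<and>
     (\<forall>a. \<Delta>' (f a) = tensor_map s' f (\<Delta> a)) \<and> (\<forall>a. \<epsilon>' (f a) = \<epsilon> a)"


section \<open>The divided power coalgebra\<close>

text \<open>
  The underlying vector space is \<open>nat \<Rightarrow>\<^sub>0 'k\<close> with scalar multiplication \<open>fscale\<close>, and
  \<open>c\<^sub>n\<close> is \<open>basis_vec n\<close>.
\<close>

definition dp_comult :: "(nat \<Rightarrow>\<^sub>0 'k::field) \<Rightarrow> ((nat \<Rightarrow>\<^sub>0 'k) \<times> (nat \<Rightarrow>\<^sub>0 'k) \<Rightarrow>\<^sub>0 'k) set" where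
  "dp_comult p = tensor_class fscale
     (linext fscale (\<lambda>n. \<Sum>(i, j)\<in>{(i, j). i + j = n}. basis_vec (basis_vec i, basis_vec j)) p)"

definition dp_counit :: "(nat \<Rightarrow>\<^sub>0 'k::field) \<Rightarrow> 'k" where
  "dp_counit = linext (*) (\<lambda>n. if n = 0 then 1 else 0)"

end

theory Submission
  imports Defs
begin

text \<open>
  A functional \<open>f\<close> acts on a coalgebra \<open>C\<close> in two ways, \<open>lact f x = \<Sum> f(x\<^sub>1) x\<^sub>2\<close> and
  \<open>ract f x = \<Sum> x\<^sub>1 f(x\<^sub>2)\<close>. By coassociativity the operators \<open>lact f\<close> commute with the operators
  \<open>ract g\<close> (\<open>lact_ract\<close>). The subspaces that are stable under all \<open>lact f\<close> are left subcomodules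
  (\<open>left_subcomodule_if_stable\<close>), and each \<open>ract g\<close> is an endomorphism of \<open>C\<close> for this structure, so
  it maps stable subspaces to stable subspaces and pulls them back to such. The stable subspace
  generated by an element is finite-dimensional. Together with the chain condition this gives, for
  every \<open>P \<noteq> C\<close>, a finite-dimensional least one among the stable subspaces not contained in \<open>P\<close>
  (\<open>least_outside_exists\<close>).

  Let \<open>S\<close> be the smallest nonzero stable subspace. Each \<open>ract g\<close> maps \<open>S\<close> to itself and has an
  eigenvector there, because \<open>K\<close> is algebraically closed; so \<open>ract g\<close> is a scalar \<open>\<mu>\<close> on \<open>S\<close>, by
  Schur's argument. Applying the counit gives \<open>g(s) = \<mu> \<epsilon>(s)\<close> for every \<open>s\<close> in \<open>S\<close>. As \<open>g\<close> is
  arbitrary, \<open>\<epsilon>\<close> is injective on \<open>S\<close> (\<open>counit_eq_0_on_socle\<close>), and \<open>S\<close> is a line.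

  Let \<open>N\<close> be the smallest stable subspace not inside \<open>S\<close>, and let \<open>X\<close> be a functional that vanishes
  on \<open>S\<close> but not on \<open>N\<close>. Then \<open>D = ract X\<close> has kernel exactly \<open>S\<close>. It is surjective: otherwise its
  range, being comparable with a cyclic subspace not inside it, is finite-dimensional, and so is \<open>C\<close>
  (\<open>exists_shift\<close>). Surjectivity gives a sequence with \<open>D c\<^bsub>n+1\<^esub> = c\<^sub>n\<close>, \<open>D c\<^sub>0 = 0\<close> and
  \<open>\<epsilon>(c\<^sub>n) = \<delta>\<^bsub>0,n\<^esub>\<close>. The elements killed by a power of \<open>D\<close> form a stable subspace that contains all
  \<open>c\<^sub>n\<close>; it is infinite-dimensional, so it lies in no cyclic subspace, and it is all of \<open>C\<close>. Hence
  \<open>x \<mapsto> \<Sum> \<epsilon>(D\<^sup>n x) e\<^sub>n\<close>, where \<open>e\<^sub>n\<close> is the standard basis of the divided power coalgebra, is a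
  well-defined linear bijection (\<open>iso_divided_power\<close>). It respects comultiplication because \<open>ract (\<epsilon> \<circ> D\<^sup>j) = D\<^sup>j\<close>, so
  that the coordinate of \<open>\<Delta> x\<close> at \<open>e\<^sub>i \<otimes> e\<^sub>j\<close> is \<open>\<epsilon>(D\<^sup>i (D\<^sup>j x))\<close>, which is the coordinate of
  \<open>x\<close> at \<open>e\<^bsub>i+j\<^esub>\<close>.
\<close>

section \<open>Linear extension from a free vector space\<close>

lemma lookup_basis_vec: "Poly_Mapping.lookup (basis_vec a) b = (if b = a then 1 else 0)"
  by (simp add: basis_vec_def lookup_single when_def)

lemma linext_eq_sum:
  assumes "vector_space s" "finite A" "Poly_Mapping.keys p \<subseteq> A"
  shows "linext s f p = (\<Sum>a\<in>A. s (Poly_Mapping.lookup p a) (f a))"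
proof -
  interpret vector_space s by fact
  show ?thesis
    unfolding linext_def
    by (rule sum.mono_neutral_left) (use assms in \<open>auto simp: in_keys_iff\<close>)
qed

lemma linear_linext:
  assumes "vector_space s"
  shows "Vector_Spaces.linear fscale s (linext s f)"
proof -
  interpret vector_space s by fact
  have "linext s f (p + q) = linext s f p + linext s f q" for p q
  proof -
    let ?A = "Poly_Mapping.keys p \<union> Poly_Mapping.keys q"
    have "Poly_Mapping.keys (p + q) \<subseteq> ?A" by (rule keys_add)
    then show ?thesis
      by (simp add: linext_eq_sum[OF assms, of ?A] lookup_add scale_left_distrib sum.distrib)
  qed
  moreover have "linext s f (fscale c p) = s c (linext s f p)" for c p
  proof -
    have "Poly_Mapping.keys (fscale c p) \<subseteq> Poly_Mapping.keys p" by (auto simp: in_keys_iff)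
    then show ?thesis
      by (simp add: linext_eq_sum[OF assms, of "Poly_Mapping.keys p"] scale_sum_right)
  qed
  ultimately show ?thesis
    by (simp add: Vector_Spaces.linear_iff assms free.vector_space_axioms)
qed

lemma linext_basis_vec: "vector_space s \<Longrightarrow> linext s f (basis_vec a) = f a"
  by (simp add: linext_def basis_vec_def vector_space.vector_space_assms(4))

lemma linext_cong:
  "(\<And>a. a \<in> Poly_Mapping.keys t \<Longrightarrow> f a = g a) \<Longrightarrow> linext s f t = linext s g t"
  by (simp add: linext_def)

lemma linear_comp_linext:
  assumes "Vector_Spaces.linear s s' F"
  shows "F (linext s f t) = linext s' (\<lambda>a. F (f a)) t"
proof -
  interpret Vector_Spaces.linear s s' F by fact
  show ?thesis by (simp add: linext_def sum scale)
qed

lemma linext_basis_vec_self: "linext fscale basis_vec t = t"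
  by (rule poly_mapping_eqI)
    (simp add: linext_def lookup_sum basis_vec_def lookup_single when_def if_distrib sum.delta
       in_keys_iff cong: if_cong)

lemma linext_linext:
  "vector_space s \<Longrightarrow> linext s f (linext fscale h t) = linext s (\<lambda>a. linext s f (h a)) t"
  by (rule linear_comp_linext[OF linear_linext])

lemma linext_push: "vector_space s \<Longrightarrow> linext s f (push h t) = linext s (\<lambda>a. f (h a)) t"
  by (simp add: push_def linext_linext linext_basis_vec)

section \<open>Multilinear maps and tensors\<close>

text \<open>
  A bilinear map out of \<open>V \<times> V\<close> extends linearly to formal sums of pairs, and this extension is
  constant on the cosets that make up \<open>V \<otimes> V\<close>. This serves as the universal property of the tensor
  product; \<open>trilin\<close> plays the same part for \<open>V \<otimes> V \<otimes> V\<close>.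
\<close>

definition bilin :: "('k::field \<Rightarrow> 'v::ab_group_add \<Rightarrow> 'v) \<Rightarrow> ('k \<Rightarrow> 'w::ab_group_add \<Rightarrow> 'w) \<Rightarrow>
    ('v \<times> 'v \<Rightarrow> 'w) \<Rightarrow> bool" where
  "bilin s s' \<phi> \<longleftrightarrow>
     (\<forall>y. Vector_Spaces.linear s s' (\<lambda>x. \<phi> (x, y))) \<and>
     (\<forall>x. Vector_Spaces.linear s s' (\<lambda>y. \<phi> (x, y)))"

definition trilin :: "('k::field \<Rightarrow> 'v::ab_group_add \<Rightarrow> 'v) \<Rightarrow> ('k \<Rightarrow> 'w::ab_group_add \<Rightarrow> 'w) \<Rightarrow>
    ('v \<times> 'v \<times> 'v \<Rightarrow> 'w) \<Rightarrow> bool" where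
  "trilin s s' \<phi> \<longleftrightarrow>
     (\<forall>y z. Vector_Spaces.linear s s' (\<lambda>x. \<phi> (x, y, z))) \<and>
     (\<forall>x z. Vector_Spaces.linear s s' (\<lambda>y. \<phi> (x, y, z))) \<and>
     (\<forall>x y. Vector_Spaces.linear s s' (\<lambda>z. \<phi> (x, y, z)))"

lemma linext_slot_rels:
  assumes "Vector_Spaces.linear s s' (\<lambda>x. \<phi> (g x))" "r \<in> slot_rels s g"
  shows "linext s' \<phi> r = 0"
proof -
  interpret f: Vector_Spaces.linear s s' "\<lambda>x. \<phi> (g x)" by fact
  interpret l: Vector_Spaces.linear fscale s' "linext s' \<phi>"
    by (rule linear_linext) unfold_locales
  have b: "linext s' \<phi> (basis_vec a) = \<phi> a" for a
    by (rule linext_basis_vec) unfold_locales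
  show ?thesis
    using assms(2) by (auto simp: slot_rels_def l.add l.diff l.scale b f.add f.scale)
qed

lemma linext_span_eq_0:
  assumes "vector_space s'" "\<And>r. r \<in> R \<Longrightarrow> linext s' \<phi> r = 0" "t \<in> free.span R"
  shows "linext s' \<phi> t = 0"
proof -
  interpret Vector_Spaces.linear fscale s' "linext s' \<phi>"
    by (rule linear_linext[OF assms(1)])
  show ?thesis using eq_0_on_span[of R t] assms by blast
qed

lemma linext_tensor_rel:
  assumes "bilin s s' \<phi>" "t \<in> tensor_rel s"
  shows "linext s' \<phi> t = 0"
proof (rule linext_span_eq_0[OF _ _ assms(2)[unfolded tensor_rel_def]])
  show "vector_space s'" using assms(1) by (auto simp: bilin_def Vector_Spaces.linear_iff)
qed (use assms(1) in \<open>auto simp: bilin_def intro: linext_slot_rels[of s s' \<phi>]\<close>)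

lemma linext_tensor3_rel:
  assumes "trilin s s' \<phi>" "t \<in> tensor3_rel s"
  shows "linext s' \<phi> t = 0"
proof (rule linext_span_eq_0[OF _ _ assms(2)[unfolded tensor3_rel_def]])
  show "vector_space s'" using assms(1) by (auto simp: trilin_def Vector_Spaces.linear_iff)
next
  fix r
  assume r: "r \<in> (\<Union>y z. slot_rels s (\<lambda>x. (x, y, z))) \<union> (\<Union>x z. slot_rels s (\<lambda>y. (x, y, z))) \<union>
    (\<Union>x y. slot_rels s (\<lambda>z. (x, y, z)))"
  note v = linext_slot_rels[where \<phi> = \<phi> and s = s and s' = s']
  show "linext s' \<phi> r = 0"
    using assms(1) r v[of "\<lambda>x. (x, _, _)"] v[of "\<lambda>y. (_, y, _)"] v[of "\<lambda>z. (_, _, z)"]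
    unfolding trilin_def by blast
qed

lemma subspace_tensor_rel: "free.subspace (tensor_rel s)"
  unfolding tensor_rel_def by (rule free.subspace_span)

lemma slot_rels_left: "slot_rels s (\<lambda>x. (x, y)) \<subseteq> tensor_rel s"
  unfolding tensor_rel_def by (rule subset_trans[OF _ free.span_superset]) blast

lemma slot_rels_right: "slot_rels s (\<lambda>y. (x, y)) \<subseteq> tensor_rel s"
  unfolding tensor_rel_def by (rule subset_trans[OF _ free.span_superset]) blast

lemma tensor_class_self: "t \<in> tensor_class s t"
  using free.subspace_0[OF subspace_tensor_rel] by (simp add: tensor_class_def)

lemma tensor_class_eqI:
  assumes "t - u \<in> tensor_rel s"
  shows "tensor_class s t = tensor_class s u"
proof -
  have "x - u \<in> tensor_rel s \<longleftrightarrow> x - t \<in> tensor_rel s" for x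
  proof
    assume "x - u \<in> tensor_rel s"
    from free.subspace_diff[OF subspace_tensor_rel this assms] show "x - t \<in> tensor_rel s"
      by simp
  next
    assume "x - t \<in> tensor_rel s"
    from free.subspace_add[OF subspace_tensor_rel this assms] show "x - u \<in> tensor_rel s"
      by simp
  qed
  then show ?thesis by (auto simp: tensor_class_def)
qed

text \<open>
  The relations say how to split one sum and one scalar multiple; by induction a pure tensor splits
  along any finite linear combination in one of its entries.
\<close>

lemma slot_sum:
  assumes "free.subspace R" "slot_rels s g \<subseteq> R" "vector_space s" "finite I"
  shows "basis_vec (g (\<Sum>i\<in>I. s (c i) (x i))) - (\<Sum>i\<in>I. fscale (c i) (basis_vec (g (x i)))) \<in> R"
  using assms(4)
proof (induction I)
  case empty
  interpret vector_space s by fact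
  have "basis_vec (g (s 0 0)) - fscale 0 (basis_vec (g 0)) \<in> R"
    using assms(2) unfolding slot_rels_def by blast
  then show ?case by simp
next
  case (insert i I)
  let ?y = "\<Sum>i\<in>I. s (c i) (x i)"
  have "basis_vec (g (s (c i) (x i) + ?y)) - basis_vec (g (s (c i) (x i))) - basis_vec (g ?y) \<in> R"
    using assms(2) by (auto simp: slot_rels_def)
  moreover have "basis_vec (g (s (c i) (x i))) - fscale (c i) (basis_vec (g (x i))) \<in> R"
    using assms(2) by (auto simp: slot_rels_def)
  ultimately have "(basis_vec (g (s (c i) (x i) + ?y)) - basis_vec (g (s (c i) (x i))) - basis_vec (g ?y))
     + (basis_vec (g (s (c i) (x i))) - fscale (c i) (basis_vec (g (x i))))
     + (basis_vec (g ?y) - (\<Sum>i\<in>I. fscale (c i) (basis_vec (g (x i))))) \<in> R"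
    using insert.IH by (intro free.subspace_add[OF assms(1)])
  then show ?case using insert.hyps by (simp add: algebra_simps)
qed

text \<open>
  Expanding both entries of every pair in the standard basis shows that a tensor is determined by
  its matrix of coordinates: here \<open>linext fscale \<Psi> w\<close> is this matrix, and \<open>push\<close> turns it
  back into a formal sum of pairs of basis vectors.
\<close>

lemma tensor_expand_coords:
  fixes w :: "(nat \<Rightarrow>\<^sub>0 'k::field) \<times> (nat \<Rightarrow>\<^sub>0 'k) \<Rightarrow>\<^sub>0 'k"
  defines "\<Psi> \<equiv> \<lambda>(x, y). \<Sum>i\<in>Poly_Mapping.keys x. \<Sum>j\<in>Poly_Mapping.keys y.
     fscale (Poly_Mapping.lookup x i * Poly_Mapping.lookup y j) (basis_vec (i, j))"
  shows "w - push (\<lambda>(i, j). (basis_vec i, basis_vec j)) (linext fscale \<Psi> w) \<in> tensor_rel fscale"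
proof -
  let ?R = "tensor_rel fscale :: ((nat \<Rightarrow>\<^sub>0 'k) \<times> (nat \<Rightarrow>\<^sub>0 'k) \<Rightarrow>\<^sub>0 'k) set"
  let ?\<Phi> = "push (\<lambda>(i, j). (basis_vec i :: nat \<Rightarrow>\<^sub>0 'k, basis_vec j :: nat \<Rightarrow>\<^sub>0 'k))
     :: _ \<Rightarrow> (_ \<Rightarrow>\<^sub>0 'k)"
  have lin: "Vector_Spaces.linear fscale fscale ?\<Phi>"
    unfolding push_def[abs_def] by (rule linear_linext[OF free.vector_space_axioms])
  interpret \<Phi>: Vector_Spaces.linear fscale fscale ?\<Phi> by (fact lin)
  have *: "basis_vec p - ?\<Phi> (\<Psi> p) \<in> ?R" for p
  proof -
    obtain x y where p: "p = (x, y)" by (cases p)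
    let ?x = "Poly_Mapping.lookup x" and ?y = "Poly_Mapping.lookup y"
    let ?I = "Poly_Mapping.keys x" and ?J = "Poly_Mapping.keys y"
    have x: "(\<Sum>i\<in>?I. fscale (?x i) (basis_vec i)) = x" and y: "(\<Sum>j\<in>?J. fscale (?y j) (basis_vec j)) = y"
      using linext_basis_vec_self[of x] linext_basis_vec_self[of y] by (simp_all add: linext_def)
    have 1: "basis_vec (x, y) - (\<Sum>i\<in>?I. fscale (?x i) (basis_vec (basis_vec i, y))) \<in> ?R"
      using slot_sum[OF subspace_tensor_rel slot_rels_left[where y=y] free.vector_space_axioms finite_keys[of x],
         where c = ?x and x = basis_vec]
      by (simp add: x)
    have 2: "basis_vec (basis_vec i, y) - (\<Sum>j\<in>?J. fscale (?y j) (basis_vec (basis_vec i, basis_vec j))) \<in> ?R"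
      for i
      using slot_sum[OF subspace_tensor_rel slot_rels_right[where x="basis_vec i"]
          free.vector_space_axioms finite_keys[of y],
         where c = ?y and x = basis_vec]
      by (simp add: y)
    have 3: "(\<Sum>i\<in>?I. fscale (?x i) (basis_vec (basis_vec i, y) -
         (\<Sum>j\<in>?J. fscale (?y j) (basis_vec (basis_vec i, basis_vec j))))) \<in> ?R"
      by (intro free.subspace_sum[OF subspace_tensor_rel] free.subspace_scale[OF subspace_tensor_rel] 2)
    have "?\<Phi> (basis_vec q) = basis_vec (case q of (i, j) \<Rightarrow> (basis_vec i, basis_vec j))" for q
      by (simp add: push_def linext_basis_vec[OF free.vector_space_axioms])
    then have "?\<Phi> (\<Psi> p) = (\<Sum>i\<in>?I. \<Sum>j\<in>?J. fscale (?x i * ?y j) (basis_vec (basis_vec i, basis_vec j)))"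
      by (simp add: \<Psi>_def p \<Phi>.sum \<Phi>.scale)
    with free.subspace_add[OF subspace_tensor_rel 1 3] show ?thesis
      by (simp add: p sum_subtractf free.scale_right_diff_distrib free.scale_sum_right)
  qed
  have "w - ?\<Phi> (linext fscale \<Psi> w) =
      (\<Sum>p\<in>Poly_Mapping.keys w. fscale (Poly_Mapping.lookup w p) (basis_vec p - ?\<Phi> (\<Psi> p)))"
    using linext_basis_vec_self[of w]
    by (simp add: linext_def \<Phi>.sum \<Phi>.scale free.scale_right_diff_distrib sum_subtractf)
  also have "\<dots> \<in> ?R"
    by (intro free.subspace_sum[OF subspace_tensor_rel] free.subspace_scale[OF subspace_tensor_rel] *)
  finally show ?thesis .
qed

text \<open>
  Coordinates make membership in the span of the relations accessible: equality of cosets is reduced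
  to equations between scalars.
\<close>

lemma tensor_class_eqI_coords:
  fixes t u :: "(nat \<Rightarrow>\<^sub>0 'k::field) \<times> (nat \<Rightarrow>\<^sub>0 'k) \<Rightarrow>\<^sub>0 'k"
  assumes "\<And>i j. linext (*) (\<lambda>(x, y). Poly_Mapping.lookup x i * Poly_Mapping.lookup y j) t =
                 linext (*) (\<lambda>(x, y). Poly_Mapping.lookup x i * Poly_Mapping.lookup y j) u"
  shows "tensor_class fscale t = tensor_class fscale u"
proof -
  define \<Psi> :: "(nat \<Rightarrow>\<^sub>0 'k) \<times> (nat \<Rightarrow>\<^sub>0 'k) \<Rightarrow> (nat \<times> nat \<Rightarrow>\<^sub>0 'k)"
    where "\<Psi> = (\<lambda>(x, y). \<Sum>i\<in>Poly_Mapping.keys x. \<Sum>j\<in>Poly_Mapping.keys y.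
     fscale (Poly_Mapping.lookup x i * Poly_Mapping.lookup y j) (basis_vec (i, j)))"
  have l: "Poly_Mapping.lookup (\<Psi> (x, y)) (i, j) = Poly_Mapping.lookup x i * Poly_Mapping.lookup y j"
    for x y i j
  proof -
    have "Poly_Mapping.lookup (\<Psi> (x, y)) (i, j) =
      (\<Sum>i'\<in>Poly_Mapping.keys x. \<Sum>j'\<in>Poly_Mapping.keys y.
        (if i' = i then Poly_Mapping.lookup x i' else 0) * (if j' = j then Poly_Mapping.lookup y j' else 0))"
      unfolding \<Psi>_def prod.case lookup_sum lookup_fscale lookup_basis_vec
      by (intro sum.cong refl) simp
    also have "\<dots> = (\<Sum>i'\<in>Poly_Mapping.keys x. if i' = i then Poly_Mapping.lookup x i' else 0) *
        (\<Sum>j'\<in>Poly_Mapping.keys y. if j' = j then Poly_Mapping.lookup y j' else 0)"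
      by (rule sum_product[symmetric])
    also have "\<dots> = Poly_Mapping.lookup x i * Poly_Mapping.lookup y j"
      by (auto simp: sum.delta in_keys_iff)
    finally show ?thesis .
  qed
  have "Poly_Mapping.lookup (linext fscale \<Psi> w) (i, j) =
     linext (*) (\<lambda>(x, y). Poly_Mapping.lookup x i * Poly_Mapping.lookup y j) w" for w i j
    by (auto simp: linext_def lookup_sum l split_beta intro!: sum.cong)
  then have "linext fscale \<Psi> t = linext fscale \<Psi> u"
    using assms by (intro poly_mapping_eqI) auto
  then show ?thesis
    using tensor_class_eqI[OF tensor_expand_coords[of t]] tensor_class_eqI[OF tensor_expand_coords[of u]]
    unfolding \<Psi>_def by simp
qed

lemma vector_space_mult: "vector_space ((*) :: 'k::field \<Rightarrow> 'k \<Rightarrow> 'k)"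
  by unfold_locales (simp_all add: algebra_simps)

lemma linext_coordinate: "linext (*) (\<lambda>n. if n = m then 1 else 0) p = Poly_Mapping.lookup p m"
  by (simp add: linext_def if_distrib sum.delta in_keys_iff cong: if_cong)

text \<open>
  The coordinate of \<open>\<Delta> p\<close> at \<open>e\<^sub>i \<otimes> e\<^sub>j\<close>, for \<open>p\<close> in the divided power coalgebra with standard basis
  \<open>e\<^sub>n\<close>.
\<close>

lemma coords_dp_comult:
  fixes p :: "nat \<Rightarrow>\<^sub>0 'k::field"
  shows "linext (*) (\<lambda>(x, y). Poly_Mapping.lookup x i * Poly_Mapping.lookup y j)
      (linext fscale (\<lambda>n. \<Sum>(i, j)\<in>{(i, j). i + j = n}. basis_vec (basis_vec i, basis_vec j)) p)
    = Poly_Mapping.lookup p (i + j)"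
    (is "linext (*) ?\<phi> (linext fscale ?d p) = _")
proof -
  interpret l: Vector_Spaces.linear fscale "(*)" "linext (*) ?\<phi>"
    by (rule linear_linext[OF vector_space_mult])
  have "linext (*) ?\<phi> (?d n) = (if n = i + j then 1 else 0)" for n
  proof -
    have "linext (*) ?\<phi> (?d n) = (\<Sum>p\<in>{(i, j). i + j = n}.
        linext (*) ?\<phi> (case p of (i, j) \<Rightarrow> basis_vec (basis_vec i, basis_vec j)))"
      by (rule l.sum)
    also have "\<dots> = (\<Sum>p\<in>{(i, j). i + j = n}. if p = (i, j) then 1 else 0)"
      by (intro sum.cong refl)
        (auto simp: linext_basis_vec[OF vector_space_mult] lookup_basis_vec split: if_splits)
    finally have "linext (*) ?\<phi> (?d n) = \<dots>" .
    moreover have "finite {(i, j). i + j = n}"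
      by (rule finite_subset[of _ "{..n} \<times> {..n}"]) auto
    ultimately show ?thesis by (simp add: sum.delta eq_commute)
  qed
  then show ?thesis by (simp add: linext_linext[OF vector_space_mult] linext_coordinate)
qed

section \<open>The two actions of functionals on a coalgebra\<close>

abbreviation functional :: "('k::field \<Rightarrow> 'v::ab_group_add \<Rightarrow> 'v) \<Rightarrow> ('v \<Rightarrow> 'k) \<Rightarrow> bool" where
  "functional s f \<equiv> Vector_Spaces.linear s (*) f"

context coalgebra
begin

text \<open>
  In Sweedler notation this is \<open>\<Sum> \<phi> (x\<^sub>1, x\<^sub>2)\<close>. For bilinear \<open>\<phi>\<close> the chosen representative of
  \<open>\<Delta> x\<close> is immaterial.
\<close>

definition sweedler :: "('k \<Rightarrow> 'w::ab_group_add \<Rightarrow> 'w) \<Rightarrow> ('c \<times> 'c \<Rightarrow> 'w) \<Rightarrow> 'c \<Rightarrow> 'w" where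
  "sweedler s \<phi> x = linext s \<phi> (SOME t. t \<in> comult x)"

lemma comult_eq_tensor_class: "t \<in> comult x \<Longrightarrow> comult x = tensor_class scale t"
proof -
  assume t: "t \<in> comult x"
  obtain p where p: "comult x = tensor_class scale p"
    using comult_in_tensor_space[of x] by (auto simp: tensor_space_def)
  with t have "t - p \<in> tensor_rel scale" by (simp add: tensor_class_def)
  from tensor_class_eqI[OF this] show ?thesis by (simp add: p)
qed

lemma comult_nonempty: "\<exists>t. t \<in> comult x"
  using comult_in_tensor_space[of x] tensor_class_self by (fastforce simp: tensor_space_def)

lemma sweedler_eq:
  assumes "bilin scale s \<phi>" "t \<in> comult x"
  shows "sweedler s \<phi> x = linext s \<phi> t"
proof -
  let ?u = "SOME t. t \<in> comult x"
  have "?u \<in> comult x" using assms(2) by (rule someI)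
  then have *: "?u - t \<in> tensor_rel scale"
    by (simp add: comult_eq_tensor_class[OF assms(2)] tensor_class_def)
  have "vector_space s" using assms(1) by (simp add: bilin_def Vector_Spaces.linear_iff)
  then interpret Vector_Spaces.linear fscale s "linext s \<phi>" by (rule linear_linext)
  from linext_tensor_rel[OF assms(1) *] show ?thesis
    by (simp add: sweedler_def diff)
qed

lemma linear_sweedler:
  assumes "bilin scale s \<phi>"
  shows "Vector_Spaces.linear scale s (sweedler s \<phi>)"
proof -
  have vs: "vector_space s" using assms(1) by (simp add: bilin_def Vector_Spaces.linear_iff)
  then interpret Vector_Spaces.linear fscale s "linext s \<phi>" by (rule linear_linext)
  have "sweedler s \<phi> (x + y) = sweedler s \<phi> x + sweedler s \<phi> y" for x y
  proof -
    obtain t u where tu: "t \<in> comult x" "u \<in> comult y" using comult_nonempty by blast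
    then have "t + u \<in> comult (x + y)"
      using tensor_class_self by (auto simp: comult_add tensor_add_def)
    with tu show ?thesis by (simp add: sweedler_eq[OF assms] add)
  qed
  moreover have "sweedler s \<phi> (scale c x) = s c (sweedler s \<phi> x)" for c x
  proof -
    obtain t where t: "t \<in> comult x" using comult_nonempty by blast
    then have "fscale c t \<in> comult (scale c x)"
      using tensor_class_self by (auto simp: comult_scale tensor_scale_def)
    with t show ?thesis by (simp add: sweedler_eq[OF assms] scale)
  qed
  ultimately show ?thesis
    using vs by (simp add: Vector_Spaces.linear_iff vector_space_axioms)
qed

lemma linear_comp_sweedler:
  "Vector_Spaces.linear s s' F \<Longrightarrow> F (sweedler s \<phi> x) = sweedler s' (\<lambda>p. F (\<phi> p)) x"
  by (simp add: sweedler_def linear_comp_linext)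

text \<open>
  Both sides are \<open>\<Sum> \<phi> (x\<^sub>1, x\<^sub>2, x\<^sub>3)\<close>. An element of the common coset given by coassociativity
  involves one choice of representatives for \<open>\<Delta> \<otimes> id\<close> and another one for \<open>id \<otimes> \<Delta>\<close>; the two
  bilinearity hypotheses make the sums independent of these choices.
\<close>

lemma sweedler_coassoc:
  assumes tri: "trilin scale s \<phi>"
    and left: "bilin scale s (\<lambda>(x, y). sweedler s (\<lambda>(u, v). \<phi> (u, v, y)) x)"
    and right: "bilin scale s (\<lambda>(x, y). sweedler s (\<lambda>(u, v). \<phi> (x, u, v)) y)"
  shows "sweedler s (\<lambda>(x, y). sweedler s (\<lambda>(u, v). \<phi> (u, v, y)) x) a =
         sweedler s (\<lambda>(x, y). sweedler s (\<lambda>(u, v). \<phi> (x, u, v)) y) a"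
proof -
  have vs: "vector_space s" using tri by (simp add: trilin_def Vector_Spaces.linear_iff)
  then interpret Vector_Spaces.linear fscale s "linext s \<phi>" by (rule linear_linext)
  have bl: "bilin scale s (\<lambda>(u, v). \<phi> (u, v, y))" and br: "bilin scale s (\<lambda>(u, v). \<phi> (y, u, v))" for y
    using tri by (simp_all add: trilin_def bilin_def)
  obtain t where t: "t \<in> comult a" using comult_nonempty by blast
  obtain d where d: "\<forall>x. d x \<in> comult x" using comult_nonempty by metis
  let ?l = "\<lambda>d t. linext fscale (\<lambda>(x, y). push (\<lambda>(u, v). (u, v, y)) (d x)) t"
  let ?r = "\<lambda>d t. linext fscale (\<lambda>(x, y). push (\<lambda>(u, v). (x, u, v)) (d y)) t"
  have "0 \<in> tensor3_rel scale" by (simp add: tensor3_rel_def free.span_zero)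
  then have "?l d t \<in> comult_left scale comult (comult a)"
    using t d by (auto simp: comult_left_def tensor3_class_def intro!: bexI[of _ t] exI[of _ d])
  then obtain t' d' where t': "t' \<in> comult a" and d': "\<forall>x. d' x \<in> comult x"
    and *: "?l d t - ?r d' t' \<in> tensor3_rel scale"
    by (auto simp: coassoc comult_right_def tensor3_class_def)
  have "sweedler s (\<lambda>(x, y). sweedler s (\<lambda>(u, v). \<phi> (u, v, y)) x) a
      = linext s (\<lambda>(x, y). sweedler s (\<lambda>(u, v). \<phi> (u, v, y)) x) t"
    by (rule sweedler_eq[OF left t])
  also have "\<dots> = linext s (\<lambda>(x, y). linext s (\<lambda>(u, v). \<phi> (u, v, y)) (d x)) t"
    by (simp add: sweedler_eq[OF bl d[rule_format]])
  also have "\<dots> = linext s \<phi> (?l d t)"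
    by (simp add: linext_linext[OF vs] linext_push[OF vs] case_prod_unfold)
  also have "\<dots> = linext s \<phi> (?r d' t')"
    using linext_tensor3_rel[OF tri *] by (simp add: diff)
  also have "\<dots> = linext s (\<lambda>(x, y). linext s (\<lambda>(u, v). \<phi> (x, u, v)) (d' y)) t'"
    by (simp add: linext_linext[OF vs] linext_push[OF vs] case_prod_unfold)
  also have "\<dots> = linext s (\<lambda>(x, y). sweedler s (\<lambda>(u, v). \<phi> (x, u, v)) y) t'"
    by (simp add: sweedler_eq[OF br d'[rule_format]])
  also have "\<dots> = sweedler s (\<lambda>(x, y). sweedler s (\<lambda>(u, v). \<phi> (x, u, v)) y) a"
    by (rule sweedler_eq[OF right t', symmetric])
  finally show ?thesis .
qed

definition lact :: "('c \<Rightarrow> 'k) \<Rightarrow> 'c \<Rightarrow> 'c" where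
  "lact f = sweedler scale (\<lambda>(x, y). scale (f x) y)"

definition ract :: "('c \<Rightarrow> 'k) \<Rightarrow> 'c \<Rightarrow> 'c" where
  "ract g = sweedler scale (\<lambda>(x, y). scale (g y) x)"

lemma bilin_lact: "functional scale f \<Longrightarrow> bilin scale scale (\<lambda>(x, y). scale (f x) y)"
  by (simp add: bilin_def Vector_Spaces.linear_iff vector_space_axioms algebra_simps)

lemma bilin_ract: "functional scale g \<Longrightarrow> bilin scale scale (\<lambda>(x, y). scale (g y) x)"
  by (simp add: bilin_def Vector_Spaces.linear_iff vector_space_axioms algebra_simps)

lemma linear_lact: "functional scale f \<Longrightarrow> Vector_Spaces.linear scale scale (lact f)"
  unfolding lact_def by (rule linear_sweedler[OF bilin_lact])

lemma linear_ract: "functional scale g \<Longrightarrow> Vector_Spaces.linear scale scale (ract g)"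
  unfolding ract_def by (rule linear_sweedler[OF bilin_ract])

lemma lact_eq: "functional scale f \<Longrightarrow> t \<in> comult x \<Longrightarrow> lact f x = linext scale (\<lambda>(x, y). scale (f x) y) t"
  unfolding lact_def by (rule sweedler_eq[OF bilin_lact])

lemma ract_eq: "functional scale g \<Longrightarrow> t \<in> comult x \<Longrightarrow> ract g x = linext scale (\<lambda>(x, y). scale (g y) x) t"
  unfolding ract_def by (rule sweedler_eq[OF bilin_ract])

text \<open>
  Both sides are \<open>\<Sum> f(x\<^sub>1) g(x\<^sub>2)\<close>: the two actions are adjoint to each other, which allows facts
  about one of them to be tested on functionals through the other.
\<close>

lemma functional_ract:
  assumes "functional scale f" "functional scale g"
  shows "f (ract g x) = g (lact f x)"
  unfolding ract_def lact_def linear_comp_sweedler[OF assms(1)] linear_comp_sweedler[OF assms(2)]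
  using assms by (simp add: case_prod_unfold Vector_Spaces.linear_iff mult.commute)

text \<open>
  Both sides are \<open>\<Sum> f(x\<^sub>1) g(x\<^sub>3) x\<^sub>2\<close>. All further consequences of coassociativity are derived
  from this identity and adjointness.
\<close>

lemma lact_ract:
  assumes f: "functional scale f" and g: "functional scale g"
  shows "lact f (ract g x) = ract g (lact f x)"
proof -
  interpret L: Vector_Spaces.linear scale scale "lact f" by (rule linear_lact[OF f])
  interpret R: Vector_Spaces.linear scale scale "ract g" by (rule linear_ract[OF g])
  let ?\<phi> = "\<lambda>(u, v, w). scale (f u * g w) v"
  have l: "sweedler scale (\<lambda>(u, v). ?\<phi> (u, v, y)) x = scale (g y) (lact f x)" for x y
  proof -
    have "Vector_Spaces.linear scale scale (scale (g y))" by (rule linear_scale_self)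
    from linear_comp_sweedler[OF this] show ?thesis by (simp add: lact_def case_prod_unfold mult.commute)
  qed
  have r: "sweedler scale (\<lambda>(u, v). ?\<phi> (x, u, v)) y = scale (f x) (ract g y)" for x y
  proof -
    have "Vector_Spaces.linear scale scale (scale (f x))" by (rule linear_scale_self)
    from linear_comp_sweedler[OF this] show ?thesis by (simp add: ract_def case_prod_unfold)
  qed
  have "lact f (ract g x) = sweedler scale (\<lambda>(x, y). scale (g y) (lact f x)) x"
    unfolding ract_def linear_comp_sweedler[OF linear_lact[OF f]] by (simp add: case_prod_unfold L.scale)
  also have "\<dots> = sweedler scale (\<lambda>(x, y). scale (f x) (ract g y)) x"
  proof (rule sweedler_coassoc[of scale ?\<phi>, unfolded l r])
    show "trilin scale scale ?\<phi>"
      using f g by (simp add: trilin_def Vector_Spaces.linear_iff vector_space_axioms algebra_simps)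
    show "bilin scale scale (\<lambda>(x, y). scale (g y) (lact f x))"
      using g by (simp add: bilin_def Vector_Spaces.linear_iff vector_space_axioms algebra_simps L.add L.scale)
    show "bilin scale scale (\<lambda>(x, y). scale (f x) (ract g y))"
      using f by (simp add: bilin_def Vector_Spaces.linear_iff vector_space_axioms algebra_simps R.add R.scale)
  qed
  also have "\<dots> = ract g (lact f x)"
    unfolding lact_def linear_comp_sweedler[OF linear_ract[OF g]] by (simp add: case_prod_unfold R.scale)
  finally show ?thesis .
qed

lemma lact_counit: "lact counit x = x"
proof -
  obtain t where "t \<in> comult x" using comult_nonempty by blast
  then show ?thesis by (simp add: lact_eq[OF linear_counit] counit_left)
qed

lemma ract_counit: "ract counit x = x"
proof -
  obtain t where "t \<in> comult x" using comult_nonempty by blast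
  then show ?thesis by (simp add: ract_eq[OF linear_counit] counit_right)
qed

lemma functional_separates_subspace:
  assumes "subspace S" "n \<notin> S"
  shows "\<exists>X. functional scale X \<and> (\<forall>s\<in>S. X s = 0) \<and> X n \<noteq> 0"
proof -
  obtain b where b: "b \<subseteq> S" "independent b" "S \<subseteq> span b"
    by (rule maximal_independent_subset)
  have "span b \<subseteq> S" using b(1) assms(1) by (rule span_minimal)
  then have n: "n \<notin> span b" using assms(2) by blast
  then have ind: "independent (insert n b)" using b(2) by (rule independent_insertI)
  let ?B = "extend_basis (insert n b)"
  have B: "independent ?B" "span ?B = UNIV" "insert n b \<subseteq> ?B"
    using independent_extend_basis[OF ind] span_extend_basis[OF ind] extend_basis_superset[OF ind] by auto
  let ?X = "\<lambda>v. representation ?B v n"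
  have "functional scale ?X" by (rule linear_representation[OF B(1,2)])
  moreover have "?X s = 0" if "s \<in> S" for s
  proof -
    have "s \<in> span b" using that b(3) by blast
    moreover have "b \<subseteq> ?B" using B(3) by blast
    ultimately have "representation ?B s = representation b s"
      by (rule representation_extend[OF B(1)])
    moreover have "n \<notin> b" using n by (blast intro: span_base)
    ultimately show ?thesis using representation_ne_zero[of b s n] by auto
  qed
  moreover have "?X n \<noteq> 0" using B(3) by (simp add: representation_basis[OF B(1)])
  ultimately show ?thesis by blast
qed

lemma functional_separates:
  assumes "\<And>f. functional scale f \<Longrightarrow> f x = f y"
  shows "x = y"
proof (rule ccontr)
  assume "x \<noteq> y"
  then have "x - y \<notin> {0}" by simp
  then obtain X where X: "functional scale X" "X (x - y) \<noteq> 0"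
    using functional_separates_subspace[of "{0}" "x - y"] by auto
  then interpret Vector_Spaces.linear scale "(*)" X by simp
  show False using X assms[OF X(1)] by (simp add: diff)
qed

lemma functional_comp:
  assumes "functional scale f" "Vector_Spaces.linear scale scale F"
  shows "functional scale (\<lambda>x. f (F x))"
  using assms by (simp add: Vector_Spaces.linear_iff)

text \<open>
  Functionals multiply by convolution; the functional on the right is the convolution product of
  \<open>f\<close> and \<open>g\<close>, namely \<open>y \<mapsto> \<Sum> f(y\<^sub>1) g(y\<^sub>2)\<close>.
\<close>

lemma ract_ract:
  assumes f: "functional scale f" and g: "functional scale g"
  shows "ract f (ract g x) = ract (\<lambda>y. f (ract g y)) x"
proof (rule functional_separates)
  fix h assume h: "functional scale h"
  note fg = functional_comp[OF f linear_ract[OF g]]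
  show "h (ract f (ract g x)) = h (ract (\<lambda>y. f (ract g y)) x)"
    by (simp add: functional_ract[OF h f] functional_ract[OF h fg] lact_ract[OF h g])
qed

lemma lact_lact:
  assumes f: "functional scale f" and g: "functional scale g"
  shows "lact f (lact g x) = lact (\<lambda>y. f (lact g y)) x"
proof (rule functional_separates)
  fix h assume h: "functional scale h"
  note fg = functional_comp[OF f linear_lact[OF g]]
  show "h (lact f (lact g x)) = h (lact (\<lambda>y. f (lact g y)) x)"
    by (simp add: functional_ract[OF f h, symmetric] functional_ract[OF fg h, symmetric] lact_ract[OF g h])
qed

lemma lact_lin_comb:
  assumes f: "functional scale f" and g: "functional scale g"
  shows "functional scale (\<lambda>x. a * f x + b * g x)"
    "lact (\<lambda>x. a * f x + b * g x) x = scale a (lact f x) + scale b (lact g x)"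
    "ract (\<lambda>x. a * f x + b * g x) x = scale a (ract f x) + scale b (ract g x)"
proof -
  show fg: "functional scale (\<lambda>x. a * f x + b * g x)"
    using f g by (simp add: Vector_Spaces.linear_iff algebra_simps)
  obtain t where t: "t \<in> comult x" using comult_nonempty by blast
  show "lact (\<lambda>x. a * f x + b * g x) x = scale a (lact f x) + scale b (lact g x)"
    by (simp add: lact_eq[OF f t] lact_eq[OF g t] lact_eq[OF fg t] linext_def scale_sum_right
        sum.distrib[symmetric] algebra_simps case_prod_unfold)
  show "ract (\<lambda>x. a * f x + b * g x) x = scale a (ract f x) + scale b (ract g x)"
    by (simp add: ract_eq[OF f t] ract_eq[OF g t] ract_eq[OF fg t] linext_def scale_sum_right
        sum.distrib[symmetric] algebra_simps case_prod_unfold)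
qed

section \<open>Subcomodules\<close>

definition stable :: "'c set \<Rightarrow> bool" where
  "stable N \<longleftrightarrow> subspace N \<and> (\<forall>f x. functional scale f \<longrightarrow> x \<in> N \<longrightarrow> lact f x \<in> N)"

text \<open>
  Write \<open>\<Delta> x = \<Sum> b \<otimes> y\<^sub>b\<close> with \<open>b\<close> running through a basis. Then \<open>y\<^sub>b\<close> is the result of letting
  the coordinate functional of \<open>b\<close> act on \<open>x\<close>, and so it lies in every stable subspace
  containing \<open>x\<close>.
\<close>

lemma left_subcomodule_if_stable:
  assumes "stable N"
  shows "left_subcomodule N"
proof -
  have "comult x \<in> tensor_right_sub scale N" if x: "x \<in> N" for x
  proof -
    let ?B = "extend_basis {}"
    let ?rep = "representation ?B"
    have B: "independent ?B" "span ?B = UNIV"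
      by (rule independent_extend_basis[OF independent_empty] span_extend_basis[OF independent_empty])+
    have rep: "functional scale (\<lambda>v. ?rep v b)" for b
      by (rule linear_representation[OF B])
    obtain t where t: "t \<in> comult x" using comult_nonempty by blast
    let ?K = "Poly_Mapping.keys t" and ?t = "Poly_Mapping.lookup t"
    \<comment> \<open>The basis elements that occur in the left entries of the representative \<open>t\<close> of \<open>\<Delta> x\<close>.\<close>
    define F where "F = (\<Union>p\<in>?K. {b. ?rep (fst p) b \<noteq> 0})"
    have finF: "finite F" by (simp add: F_def finite_representation)
    have expand: "(\<Sum>b\<in>F. scale (?rep (fst p) b) b) = fst p" if "p \<in> ?K" for p
    proof -
      have "(\<Sum>b\<in>F. scale (?rep (fst p) b) b) = (\<Sum>b | ?rep (fst p) b \<noteq> 0. scale (?rep (fst p) b) b)"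
        using that by (intro sum.mono_neutral_right finF) (auto simp: F_def)
      also have "\<dots> = fst p" using B by (simp add: sum_nonzero_representation_eq)
      finally show ?thesis .
    qed
    \<comment> \<open>The representative of \<open>\<Delta> x\<close> whose right entries lie in \<open>N\<close>.\<close>
    define u where "u = (\<Sum>b\<in>F. basis_vec (b, lact (\<lambda>v. ?rep v b) x) :: ('c \<times> 'c) \<Rightarrow>\<^sub>0 'k)"
    let ?R = "tensor_rel scale"
    have 1: "basis_vec p - (\<Sum>b\<in>F. fscale (?rep (fst p) b) (basis_vec (b, snd p))) \<in> ?R"
      if "p \<in> ?K" for p
      using slot_sum[OF subspace_tensor_rel slot_rels_left[where y = "snd p"] vector_space_axioms finF,
          where c = "?rep (fst p)" and x = "\<lambda>b. b"]
      by (simp add: expand[OF that])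
    have 2: "basis_vec (b, lact (\<lambda>v. ?rep v b) x) -
         (\<Sum>p\<in>?K. fscale (?t p * ?rep (fst p) b) (basis_vec (b, snd p))) \<in> ?R" for b
      using slot_sum[OF subspace_tensor_rel slot_rels_right[where x = b] vector_space_axioms
          finite_keys[of t], where c = "\<lambda>p. ?t p * ?rep (fst p) b" and x = snd]
      by (simp add: lact_eq[OF rep t] linext_def case_prod_unfold)
    have "t - u = (\<Sum>p\<in>?K. fscale (?t p) (basis_vec p -
          (\<Sum>b\<in>F. fscale (?rep (fst p) b) (basis_vec (b, snd p)))))
       - (\<Sum>b\<in>F. basis_vec (b, lact (\<lambda>v. ?rep v b) x) -
          (\<Sum>p\<in>?K. fscale (?t p * ?rep (fst p) b) (basis_vec (b, snd p))))"
    proof -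
      have "(\<Sum>b\<in>F. \<Sum>p\<in>?K. fscale (?t p * ?rep (fst p) b) (basis_vec (b, snd p)))
          = (\<Sum>p\<in>?K. \<Sum>b\<in>F. fscale (?t p * ?rep (fst p) b) (basis_vec (b, snd p)) :: ('c \<times> 'c) \<Rightarrow>\<^sub>0 'k)"
        by (rule sum.swap)
      moreover have "(\<Sum>p\<in>?K. fscale (?t p) (basis_vec p)) = t"
        using linext_basis_vec_self[of t] by (simp add: linext_def)
      ultimately show ?thesis
        by (simp add: u_def sum_subtractf free.scale_right_diff_distrib free.scale_sum_right)
    qed
    also have "\<dots> \<in> ?R"
      by (rule free.subspace_diff[OF subspace_tensor_rel];
          intro free.subspace_sum[OF subspace_tensor_rel] free.subspace_scale[OF subspace_tensor_rel] 1 2)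
    finally have "comult x = tensor_class scale u"
      using comult_eq_tensor_class[OF t] tensor_class_eqI by simp
    moreover have "Poly_Mapping.keys u \<subseteq> UNIV \<times> N"
    proof -
      have "lact (\<lambda>v. ?rep v b) x \<in> N" for b
        using assms x rep by (simp add: stable_def)
      then have "Poly_Mapping.lookup u p = 0" if "snd p \<notin> N" for p
        using that by (auto simp: u_def lookup_sum lookup_basis_vec intro!: sum.neutral)
      then show ?thesis by (force simp: in_keys_iff)
    qed
    ultimately show ?thesis by (auto simp: tensor_right_sub_def)
  qed
  then show ?thesis using assms by (auto simp: left_subcomodule_def stable_def)
qed

definition cyclic :: "'c \<Rightarrow> 'c set" where
  "cyclic x = {lact f x | f. functional scale f}"

lemma stable_cyclic: "stable (cyclic x)"
proof -
  have "functional scale (\<lambda>x. 0)" 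
    by (simp add: Vector_Spaces.linear_iff vector_space_axioms vector_space_mult)
  moreover have "lact (\<lambda>x. 0) x = 0" by (simp add: lact_def sweedler_def linext_def case_prod_unfold)
  ultimately have "0 \<in> cyclic x" unfolding cyclic_def by force
  moreover have "scale a y + scale b z \<in> cyclic x" if "y \<in> cyclic x" "z \<in> cyclic x" for y z a b
    using that unfolding cyclic_def using lact_lin_comb(1,2) by (smt (verit) mem_Collect_eq)
  from this[where ?a1 = 1 and ?b1 = 1] this[where ?b1 = 0]
  have "y + z \<in> cyclic x" "scale a y \<in> cyclic x" if "y \<in> cyclic x" "z \<in> cyclic x" for y z a
    using that by auto
  ultimately have "subspace (cyclic x)" unfolding subspace_def by blast
  moreover have "lact f y \<in> cyclic x" if f: "functional scale f" and "y \<in> cyclic x" for f y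
    using that lact_lact[OF f] functional_comp[OF f linear_lact] unfolding cyclic_def by blast
  ultimately show ?thesis by (simp add: stable_def)
qed

lemma cyclic_self: "x \<in> cyclic x"
  unfolding cyclic_def using linear_counit lact_counit[of x, symmetric] by blast

lemma cyclic_subset: "stable N \<Longrightarrow> x \<in> N \<Longrightarrow> cyclic x \<subseteq> N"
  by (auto simp: stable_def cyclic_def)

text \<open>
  The finiteness theorem for comodules: \<open>\<Sum> f(x\<^sub>1) x\<^sub>2\<close> is a combination of the right entries of a
  representative of \<open>\<Delta> x\<close> that does not depend on \<open>f\<close>.
\<close>

lemma cyclic_finite: "\<exists>F. finite F \<and> cyclic x \<subseteq> span F"
proof -
  obtain t where t: "t \<in> comult x" using comult_nonempty by blast
  have "lact f x \<in> span (snd ` Poly_Mapping.keys t)" if "functional scale f" for f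
    unfolding lact_eq[OF that t] linext_def case_prod_unfold
    by (intro span_sum span_scale) (auto intro: span_base)
  then show ?thesis by (auto simp: cyclic_def intro!: exI[of _ "snd ` Poly_Mapping.keys t"])
qed

end

section \<open>Eigenvectors\<close>

text \<open>
  The vectors \<open>x, F x, F\<^sup>2 x, \<dots>\<close> lie in a finite-dimensional space, so some nonzero polynomial in
  \<open>F\<close> kills \<open>x\<close>. Take one of least degree and split off a linear factor for a root \<open>\<mu>\<close>: the
  cofactor sends \<open>x\<close> to an eigenvector. The ambient space may be infinite-dimensional.
\<close>

lemma eigenvector_exists:
  fixes s :: "'k::alg_closed_field \<Rightarrow> 'v::ab_group_add \<Rightarrow> 'v"
  assumes F: "Vector_Spaces.linear s s F"
    and S: "module.subspace s S" "F ` S \<subseteq> S" "finite B" "S \<subseteq> module.span s B"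
    and x: "x \<in> S" "x \<noteq> 0"
  shows "\<exists>v\<in>S. v \<noteq> 0 \<and> (\<exists>\<mu>. F v = s \<mu> v)"
proof -
  interpret Vector_Spaces.linear s s F by fact
  \<comment> \<open>The value of \<open>p(F)\<close> at \<open>x\<close>, by Horner's scheme.\<close>
  define ev where "ev p = fold_coeffs (\<lambda>a z. s a x + F z) p 0" for p
  have ev_0: "ev 0 = 0" by (simp add: ev_def)
  have ev_pCons: "ev (pCons a p) = s a x + F (ev p)" for a p
    by (cases "a = 0 \<and> p = 0") (auto simp: ev_def zero)
  have ev_add: "ev (p + q) = ev p + ev q" for p q
    by (induction p q rule: poly_induct2)
      (simp_all add: ev_0 ev_pCons add vs1.scale_left_distrib)
  have ev_smult: "ev (smult c p) = s c (ev p)" for c p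
    by (induction p) (simp_all add: ev_0 ev_pCons scale vs1.scale_right_distrib)
  have ev_monom: "ev (monom c i) = s c ((F ^^ i) x)" for c i
    by (induction i) (simp_all add: monom_0 monom_Suc ev_pCons ev_0 zero scale)
  have ev_sum: "ev (sum p I) = (\<Sum>i\<in>I. ev (p i))" for p and I :: "nat set"
    by (induction I rule: infinite_finite_induct) (simp_all add: ev_0 ev_add)
  have ev_S: "ev p \<in> S" for p
    using S(1,2) x(1)
    by (induction p) (auto simp: ev_0 ev_pCons vs1.subspace_0 intro!: vs1.subspace_add vs1.subspace_scale)
  have "\<exists>p. p \<noteq> 0 \<and> ev p = 0"
  proof (rule ccontr)
    assume *: "\<nexists>p. p \<noteq> 0 \<and> ev p = 0"
    let ?v = "\<lambda>i. (F ^^ i) x"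
    have "inj ?v"
    proof (rule injI)
      fix i j assume "?v i = ?v j"
      then have "ev (monom 1 i + smult (-1) (monom 1 j)) = 0"
        by (simp only: ev_add ev_smult ev_monom) simp
      then have "monom 1 i + smult (-1) (monom 1 j) = (0 :: 'k poly)" using * by blast
      then have "coeff (monom (1::'k) i) i = coeff (monom 1 j) i"
        by (metis add.right_neutral add_uminus_conv_diff diff_add_cancel smult_minus_left smult_1_left add_0)
      then show "i = j" by (simp split: if_splits)
    qed
    have ind: "vs1.independent (?v ` {..n})" for n
    proof (rule vs1.independent_if_scalars_zero)
      fix c y assume c: "(\<Sum>y\<in>?v ` {..n}. s (c y) y) = 0" and y: "y \<in> ?v ` {..n}"
      have "(\<Sum>i\<le>n. s (c (?v i)) (?v i)) = 0"
        using c by (subst (asm) sum.reindex) (auto intro: inj_on_subset[OF \<open>inj ?v\<close>])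
      then have "ev (\<Sum>i\<le>n. monom (c (?v i)) i) = 0" by (simp add: ev_sum ev_monom)
      then have "(\<Sum>i\<le>n. monom (c (?v i)) i) = 0" using * by blast
      then have "coeff (\<Sum>i\<le>n. monom (c (?v i)) i) j = 0" for j by simp
      then have "i \<le> n \<Longrightarrow> c (?v i) = 0" for i
        by (simp add: coeff_sum coeff_monom) metis
      then show "c y = 0" using y by auto
    qed simp
    have "?v i \<in> S" for i using ev_S[of "monom 1 i"] by (simp add: ev_monom)
    then have "?v ` {..card B} \<subseteq> vs1.span B" using S(4) by blast
    then have "card (?v ` {..card B}) \<le> card B"
      using vs1.independent_span_bound[OF S(3) ind] by blast
    then show False
      by (simp add: card_image[OF inj_on_subset[OF \<open>inj ?v\<close>]])
  qed
  then obtain p where p: "p \<noteq> 0" "ev p = 0"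
    and min: "\<And>q. q \<noteq> 0 \<Longrightarrow> ev q = 0 \<Longrightarrow> degree p \<le> degree q"
    using ex_has_least_nat[of "\<lambda>p. p \<noteq> 0 \<and> ev p = 0" _ degree] by blast
  have "degree p > 0"
  proof (rule ccontr)
    assume "\<not> degree p > 0"
    then obtain c where c: "p = [:c:]" by (metis degree_eq_zeroE gr0I)
    then show False using p x by (simp add: ev_pCons ev_0 zero)
  qed
  then obtain \<mu> where "poly p \<mu> = 0" using alg_closed_imp_poly_has_root by blast
  then obtain q where q: "p = [:-\<mu>, 1:] * q" by (metis dvdE poly_eq_0_iff_dvd)
  have "q \<noteq> 0" using p q by auto
  moreover have "degree p = Suc (degree q)"
    unfolding q using \<open>q \<noteq> 0\<close> by (subst degree_mult_eq) auto
  ultimately have "ev q \<noteq> 0" using min[of q] by auto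
  moreover have "ev p = s (-\<mu>) (ev q) + F (ev q)"
    unfolding q by (simp add: ev_add ev_smult ev_pCons ev_0 flip: smult_minus_left)
  then have "F (ev q) = s \<mu> (ev q)" using p(2) by (simp add: add_eq_0_iff)
  ultimately show ?thesis using ev_S by blast
qed

section \<open>Chain coalgebras\<close>

lemma (in vector_space) subspace_eq_if_dim_le:
  assumes A: "subspace A" "A \<subseteq> C" and C: "C \<subseteq> span F" "finite F" and le: "dim C \<le> dim A"
  shows "A = C"
proof (rule ccontr)
  assume "A \<noteq> C"
  then obtain y where y: "y \<in> C" "y \<notin> A" using A(2) by blast
  obtain a where a: "a \<subseteq> A" "independent a" "A \<subseteq> span a" "card a = dim A" by (rule basis_exists)
  obtain c where c: "c \<subseteq> C" "independent c" "C \<subseteq> span c" "card c = dim C" by (rule basis_exists)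
  have "finite c" using independent_span_bound[OF C(2) c(2)] c(1) C(1) by blast
  have "span a \<subseteq> A" by (rule span_minimal[OF a(1) A(1)])
  with y have "y \<notin> span a" by blast
  then have i: "independent (insert y a)" and "y \<notin> a"
    using independent_insertI[OF _ a(2)] span_base by blast+
  from independent_span_bound[OF \<open>finite c\<close> i] have *: "finite (insert y a)" "card (insert y a) \<le> card c"
    using y a(1) A(2) c(3) by auto
  then show False using \<open>y \<notin> a\<close> a(4) c(4) le by simp
qed

text \<open>
  Preimages of a basis of the range, together with a spanning set of the kernel, span the space.
\<close>

lemma (in vector_space) finite_spanning_if_finite_range_kernel:
  assumes D: "Vector_Spaces.linear scale scale D"
    and "finite F" "range D \<subseteq> span F" "finite G" "{x. D x = 0} \<subseteq> span G"
  shows "\<exists>H. finite H \<and> span H = UNIV"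
proof -
  interpret D: Vector_Spaces.linear scale scale D by fact
  obtain b where b: "b \<subseteq> range D" "independent b" "range D \<subseteq> span b"
    by (rule maximal_independent_subset)
  have "finite b" using independent_span_bound[OF assms(2) b(2)] b(1) assms(3) by blast
  from b(1) have "\<forall>v\<in>b. \<exists>x. D x = v" by auto
  then obtain h where h: "\<forall>v\<in>b. D (h v) = v" by metis
  have *: "D ` span (h ` b) = span b"
    unfolding D.span_image[symmetric] image_image using h by (simp cong: image_cong)
  have "x \<in> span (h ` b \<union> G)" for x
  proof -
    have "D x \<in> D ` span (h ` b)" using * b(3) by blast
    then obtain z where z: "z \<in> span (h ` b)" "D x = D z" by blast
    then have "x - z \<in> span G" using assms(5) by (auto simp: D.diff)
    with z(1) have "z + (x - z) \<in> span (h ` b \<union> G)"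
      by (intro span_add) (use span_mono[of _ "h ` b \<union> G"] in blast)+
    then show ?thesis by simp
  qed
  then show ?thesis using \<open>finite b\<close> assms(4) by (intro exI[of _ "h ` b \<union> G"]) auto
qed

context coalgebra
begin

lemma stable_zero: "stable {0}"
proof -
  have "lact f 0 = 0" if "functional scale f" for f
  proof -
    interpret Vector_Spaces.linear scale scale "lact f" by (rule linear_lact[OF that])
    show ?thesis by (rule zero)
  qed
  then show ?thesis by (auto simp: stable_def subspace_def)
qed

lemma stable_Int: "stable M \<Longrightarrow> stable N \<Longrightarrow> stable (M \<inter> N)"
  by (auto simp: stable_def intro: subspace_inter)

lemma stable_vimage_ract:
  assumes "functional scale g" "stable P"
  shows "stable {x. ract g x \<in> P}"
proof -
  interpret Vector_Spaces.linear scale scale "ract g" by (rule linear_ract[OF assms(1)])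
  show ?thesis
    using assms(2) subspace_vimage[of P]
    by (auto simp: stable_def vimage_def lact_ract[OF _ assms(1), symmetric])
qed

lemma stable_image_ract:
  assumes "functional scale g" "stable P"
  shows "stable (ract g ` P)"
proof -
  interpret Vector_Spaces.linear scale scale "ract g" by (rule linear_ract[OF assms(1)])
  show ?thesis
    using assms(2) subspace_image[of P]
    by (auto simp: stable_def lact_ract[OF _ assms(1)])
qed

lemma stable_UNIV: "stable UNIV"
  by (simp add: stable_def)

text \<open>
  In a chain coalgebra such a \<open>Q\<close> is the socle if \<open>P = {0}\<close>, and the second term of the socle series
  if \<open>P\<close> is the socle.
\<close>

definition least_outside :: "'c set \<Rightarrow> 'c set \<Rightarrow> bool" where
  "least_outside P Q \<longleftrightarrow> stable Q \<and> \<not> Q \<subseteq> P \<and> (\<forall>L. stable L \<longrightarrow> \<not> L \<subseteq> P \<longrightarrow> Q \<subseteq> L)"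

end

context chain_coalgebra
begin

lemma stable_chain: "stable M \<Longrightarrow> stable N \<Longrightarrow> M \<subseteq> N \<or> N \<subseteq> M"
  using left_subcomodules_chain left_subcomodule_if_stable by blast

text \<open>
  Among the cyclic subspaces generated by elements outside \<open>P\<close> choose one of least dimension.
  It is comparable with each of the others, and minimality of the dimension rules out that another
  one is strictly smaller.
\<close>

lemma least_outside_exists:
  assumes "x \<notin> P"
  shows "\<exists>Q F. least_outside P Q \<and> finite F \<and> Q \<subseteq> span F"
proof -
  obtain y where y: "y \<notin> P" and min: "\<And>z. z \<notin> P \<Longrightarrow> dim (cyclic y) \<le> dim (cyclic z)"
    using ex_has_least_nat[of "\<lambda>y. y \<notin> P" x "\<lambda>y. dim (cyclic y)"] assms by blast
  obtain F where F: "finite F" "cyclic y \<subseteq> span F" using cyclic_finite by blast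
  have "cyclic y \<subseteq> L" if L: "stable L" "\<not> L \<subseteq> P" for L
  proof -
    obtain z where z: "z \<in> L" "z \<notin> P" using L(2) by blast
    have zL: "cyclic z \<subseteq> L" by (rule cyclic_subset[OF L(1) z(1)])
    show ?thesis
    proof (cases "cyclic z \<subseteq> cyclic y")
      case True
      have "subspace (cyclic z)" using stable_cyclic by (simp add: stable_def)
      from subspace_eq_if_dim_le[OF this True F(2,1) min[OF z(2)]] zL show ?thesis by simp
    next
      case False
      then show ?thesis using stable_chain[OF stable_cyclic stable_cyclic] zL by blast
    qed
  qed
  then have "least_outside P (cyclic y)"
    using y cyclic_self stable_cyclic unfolding least_outside_def by blast
  then show ?thesis using F by blast
qed

end

section \<open>The socle and the shift operator\<close>

locale infinite_chain_coalgebra = chain_coalgebra scale comult counit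
  for scale :: "'k::alg_closed_field \<Rightarrow> 'c::ab_group_add \<Rightarrow> 'c" and comult counit +
  assumes infinite_dimensional: "\<nexists>B. finite_dimensional_vector_space scale B"
begin

lemma no_finite_spanning_set: "finite H \<Longrightarrow> span H \<noteq> UNIV"
proof
  assume H: "finite H" "span H = UNIV"
  obtain B where B: "B \<subseteq> H" "independent B" "H \<subseteq> span B" by (rule maximal_independent_subset)
  have "span H \<subseteq> span B" using B(3) by (simp add: span_minimal)
  then have "span B = UNIV" using H(2) by blast
  then have "finite_dimensional_vector_space scale B"
    using B finite_subset[OF B(1) H(1)] by unfold_locales auto
  then show False using infinite_dimensional by blast
qed

text \<open>
  Schur's lemma in disguise. On the smallest nonzero stable subspace every \<open>ract g\<close> is a scalar
  \<open>\<mu>\<close>, since the kernel of \<open>ract (g - \<mu> \<epsilon>)\<close> is stable and contains an eigenvector. Applying the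
  counit, \<open>g\<close> and \<open>\<mu> \<epsilon>\<close> agree on this subspace. So an element with counit \<open>0\<close> is killed by
  every functional.
\<close>

lemma counit_eq_0_on_socle:
  assumes S: "least_outside {0} S" "finite B" "S \<subseteq> span B"
    and x: "x \<in> S" "counit x = 0"
  shows "x = 0"
proof (rule ccontr)
  assume "x \<noteq> 0"
  interpret e: Vector_Spaces.linear scale "(*)" counit by (rule linear_counit)
  have stS: "stable S" and least: "\<And>L. stable L \<Longrightarrow> \<not> L \<subseteq> {0} \<Longrightarrow> S \<subseteq> L"
    using S(1) by (auto simp: least_outside_def)
  have "g x = 0" if g: "functional scale g" for g
  proof -
    \<comment> \<open>If \<open>ract g\<close> does not kill \<open>S\<close>, then \<open>S \<subseteq> ract g ` S\<close>, so some nonzero element of \<open>S\<close> is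
      mapped into \<open>S\<close>; by leastness all of them are.\<close>
    have "S \<subseteq> {y. ract g y \<in> S}"
    proof (cases "ract g ` S \<subseteq> {0}")
      case True
      moreover have "0 \<in> S" using stS by (auto simp: stable_def subspace_0)
      ultimately show ?thesis by auto
    next
      case False
      then have "S \<subseteq> ract g ` S" by (intro least stable_image_ract[OF g stS])
      then obtain z where z: "z \<in> S" "x = ract g z" using x(1) by blast
      interpret Vector_Spaces.linear scale scale "ract g" by (rule linear_ract[OF g])
      have "z \<noteq> 0" using z \<open>x \<noteq> 0\<close> zero by auto
      then have "\<not> S \<inter> {y. ract g y \<in> S} \<subseteq> {0}" using z x(1) by auto
      from least[OF stable_Int[OF stS stable_vimage_ract[OF g stS]] this] show ?thesis by blast
    qed
    then have "ract g ` S \<subseteq> S" by blast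
    moreover have "subspace S" using stS by (simp add: stable_def)
    ultimately obtain v \<mu> where v: "v \<in> S" "v \<noteq> 0" "ract g v = scale \<mu> v"
      using eigenvector_exists[OF linear_ract[OF g] _ _ S(2,3) x(1) \<open>x \<noteq> 0\<close>] by blast
    let ?g = "\<lambda>y. 1 * g y + (-\<mu>) * counit y"
    note g' = lact_lin_comb[OF g linear_counit, of 1 "-\<mu>"]
    have "ract ?g v = 0" unfolding g'(3) by (simp add: v ract_counit)
    then have "\<not> {y. ract ?g y \<in> {0}} \<subseteq> {0}" using v by blast
    from least[OF stable_vimage_ract[OF g'(1) stable_zero] this] have "ract ?g x = 0"
      using x(1) by blast
    moreover have "counit (ract ?g x) = ?g x"
      by (simp only: functional_ract[OF linear_counit g'(1)] lact_counit)
    ultimately show "g x = 0"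
      using x(2) by (simp add: e.zero)
  qed
  then have "x = 0"
  proof (intro functional_separates)
    fix f assume f: "functional scale f"
    interpret Vector_Spaces.linear scale "(*)" f by fact
    show "f x = f 0" using \<open>\<And>g. functional scale g \<Longrightarrow> g x = 0\<close>[OF f] by (simp add: zero)
  qed
  then show False using \<open>x \<noteq> 0\<close> by simp
qed

text \<open>
  The operator \<open>ract X\<close> lowers the index of the divided powers by one, and its kernel is the line
  spanned by \<open>g\<close>. The last clause says that the counit is injective on this kernel.
\<close>

lemma exists_shift:
  "\<exists>X g. functional scale X \<and> counit g = 1 \<and> ract X g = 0 \<and> surj (ract X) \<and>
     (\<forall>x. ract X x = 0 \<longrightarrow> counit x = 0 \<longrightarrow> x = 0)"
proof -
  have "UNIV \<noteq> {0 :: 'c}" using no_finite_spanning_set[of "{}"] by auto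
  then obtain x0 :: 'c where "x0 \<notin> {0}" by blast
  then obtain S B where S: "least_outside {0} S" and B: "finite B" "S \<subseteq> span B"
    using least_outside_exists by blast
  have stS: "stable S" using S by (auto simp: least_outside_def)
  obtain s where s: "s \<in> S" "s \<noteq> 0" using S by (auto simp: least_outside_def)
  have eps: "x = 0" if "x \<in> S" "counit x = 0" for x
    by (rule counit_eq_0_on_socle[OF S B that])
  interpret e: Vector_Spaces.linear scale "(*)" counit by (rule linear_counit)
  define g where "g = scale (1 / counit s) s"
  have g: "g \<in> S" "counit g = 1"
    using s stS eps[of s] by (auto simp: g_def e.scale stable_def subspace_scale)
  have "S \<noteq> UNIV"
  proof
    assume "S = UNIV"
    then show False using B no_finite_spanning_set[OF B(1)] by auto
  qed
  then obtain x1 where "x1 \<notin> S" by blast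
  then obtain N where N: "least_outside S N" using least_outside_exists by blast
  then obtain n where n: "n \<in> N" "n \<notin> S" by (auto simp: least_outside_def)
  obtain X where X: "functional scale X" "\<forall>s\<in>S. X s = 0" "X n \<noteq> 0"
    using functional_separates_subspace[OF _ n(2)] stS by (auto simp: stable_def)
  interpret D: Vector_Spaces.linear scale scale "ract X" by (rule linear_ract[OF X(1)])
  \<comment> \<open>By adjointness, \<open>f (ract X y) = X (lact f y)\<close>, and \<open>X\<close> vanishes on the stable \<open>S\<close>.\<close>
  have "ract X y = 0" if y: "y \<in> S" for y
  proof (rule functional_separates)
    fix f assume f: "functional scale f"
    interpret f: Vector_Spaces.linear scale "(*)" f by fact
    have "lact f y \<in> S" using stS y f by (simp add: stable_def)
    then show "f (ract X y) = f 0" by (simp add: functional_ract[OF f X(1)] X(2) f.zero)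
  qed
  moreover have "{y. ract X y \<in> {0}} \<subseteq> S"
  proof (rule ccontr)
    assume "\<not> ?thesis"
    then have "N \<subseteq> {y. ract X y \<in> {0}}"
      using N stable_vimage_ract[OF X(1) stable_zero] unfolding least_outside_def by blast
    then have "counit (ract X n) = 0" using n by (auto simp: e.zero)
    then show False using X(3) by (simp add: functional_ract[OF linear_counit X(1)] lact_counit)
  qed
  ultimately have ker: "{y. ract X y = 0} = S" by auto
  \<comment> \<open>A range different from \<open>C\<close> would lie in a cyclic subspace. Then range and kernel would
    both be finite-dimensional, and so would \<open>C\<close>.\<close>
  have "surj (ract X)"
  proof (rule ccontr)
    assume "\<not> ?thesis"
    then obtain y where y: "y \<notin> range (ract X)" by blast
    then have "range (ract X) \<subseteq> cyclic y"
      using stable_chain[OF stable_image_ract[OF X(1) stable_UNIV] stable_cyclic[of y]] cyclic_self[of y]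
      by blast
    then obtain F where "finite F" "range (ract X) \<subseteq> span F" using cyclic_finite[of y] by blast
    from finite_spanning_if_finite_range_kernel[OF linear_ract[OF X(1)] this B(1)] B(2) ker
    show False using no_finite_spanning_set by auto
  qed
  then show ?thesis using X(1) g ker eps by blast
qed

text \<open>
  By \<open>ract_ract\<close>, \<open>ract\<close> turns convolution into composition, and \<open>\<epsilon> \<circ> (ract X)\<^sup>n\<close> is the \<open>n\<close>-th
  convolution power of \<open>X\<close>.
\<close>

lemma ract_counit_funpow:
  assumes X: "functional scale X"
  shows "functional scale (\<lambda>x. counit ((ract X ^^ n) x))"
    "ract (\<lambda>x. counit ((ract X ^^ n) x)) x = (ract X ^^ n) x"
proof (induction n arbitrary: x)
  case 0
  { case 1 show ?case using linear_counit by simp }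
  { case 2 show ?case using ract_counit by simp }
next
  case (Suc n)
  let ?f = "\<lambda>x. counit ((ract X ^^ n) x)"
  have eq: "(\<lambda>x. counit ((ract X ^^ Suc n) x)) = (\<lambda>x. ?f (ract X x))"
    by (simp add: funpow_swap1)
  { case 1 show ?case unfolding eq by (rule functional_comp[OF Suc.IH(1) linear_ract[OF X]]) }
  { case 2 show ?case
      unfolding eq ract_ract[OF Suc.IH(1) X, symmetric] Suc.IH(2) by (simp add: funpow_swap1) }
qed

section \<open>The isomorphism with the divided power coalgebra\<close>

lemma iso_divided_power: "\<exists>f. coalgebra_iso scale comult counit fscale dp_comult dp_counit f"
proof -
  obtain X g where X: "functional scale X" and g: "counit g = 1" "ract X g = 0"
    and surj: "surj (ract X)" and eps: "\<And>x. ract X x = 0 \<Longrightarrow> counit x = 0 \<Longrightarrow> x = 0"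
    using exists_shift by blast
  define D where "D n = ract X ^^ n" for n
  interpret e: Vector_Spaces.linear scale "(*)" counit by (rule linear_counit)
  interpret R: Vector_Spaces.linear scale scale "ract X" by (rule linear_ract[OF X])
  have D_0: "D 0 x = x" and D_Suc: "D (Suc n) x = ract X (D n x)"
    and D_Suc': "D (Suc n) x = D n (ract X x)" and D_D: "D m (D n x) = D (m + n) x" for m n x
    by (simp_all add: D_def funpow_swap1 funpow_add)
  have lin_D: "Vector_Spaces.linear scale scale (D n)" for n
    by (induction n) (simp_all add: D_0 D_Suc Vector_Spaces.linear_iff vector_space_axioms R.add R.scale)
  have D_add: "D n (x + y) = D n x + D n y" and D_scale: "D n (scale c x) = scale c (D n x)"
    and D_zero: "D n 0 = 0" for n x y c
  proof -
    interpret Vector_Spaces.linear scale scale "D n" by (rule lin_D)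
    show "D n (x + y) = D n x + D n y" "D n (scale c x) = scale c (D n x)" "D n 0 = 0"
      by (rule add scale zero)+
  qed
  have fun_D: "functional scale (\<lambda>x. counit (D n x))" for n
    unfolding D_def by (rule ract_counit_funpow[OF X])
  have ract_D: "ract (\<lambda>x. counit (D n x)) x = D n x" for n x
    unfolding D_def by (rule ract_counit_funpow[OF X])

  \<comment> \<open>Preimages under \<open>ract X\<close> can be corrected by multiples of \<open>g\<close>, which fixes their counit.\<close>
  have "\<exists>y. ract X y = w \<and> counit y = 0" for w
  proof -
    obtain y where y: "ract X y = w" using surj by (metis surjD)
    then show ?thesis
      by (intro exI[of _ "y - scale (counit y) g"])
        (simp add: R.diff R.scale e.diff e.scale g)
  qed
  then obtain step where step: "\<And>w. ract X (step w) = w" "\<And>w. counit (step w) = 0" by metis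
  define c where "c n = (step ^^ n) g" for n
  have c_0: "c 0 = g" and c_Suc: "c (Suc n) = step (c n)" for n by (simp_all add: c_def)
  have D_c: "counit (D n (c m)) = (if n = m then 1 else 0)" for m n
  proof (induction n arbitrary: m)
    case 0
    show ?case by (cases m) (simp_all add: D_0 c_0 c_Suc g step)
  next
    case (Suc n)
    show ?case by (cases m) (simp_all add: D_Suc' c_0 c_Suc g step Suc.IH D_zero e.zero)
  qed
  have D_c_0: "D (Suc n) (c n) = 0" for n
    by (induction n) (simp_all add: D_Suc' D_0 c_0 c_Suc g step del: funpow.simps)

  \<comment> \<open>The union of the kernels of the \<open>D n\<close> is stable. If it missed \<open>x\<close>, it would lie in the
    finite-dimensional \<open>cyclic x\<close>, but it contains the infinite independent family \<open>c\<close>.\<close>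
  have nilpotent: "\<exists>n. D n x = 0" for x
  proof (rule ccontr)
    assume x: "\<nexists>n. D n x = 0"
    let ?U = "{x. \<exists>n. D n x = 0}"
    have mono: "D (m + n) y = 0" if "D n y = 0" for m n y
      using that D_D[of m n y] by (simp add: D_zero)
    have "stable ?U"
    proof -
      have "0 \<in> ?U" by (auto simp: D_zero)
      moreover have "y + z \<in> ?U" if yz: "y \<in> ?U" "z \<in> ?U" for y z
      proof -
        from yz obtain m n where "D m y = 0" "D n z = 0" by blast
        then have "D (n + m) (y + z) = 0" using mono[of m y n] mono[of n z m] by (simp add: D_add add.commute)
        then show ?thesis by blast
      qed
      moreover have "scale k y \<in> ?U" if "y \<in> ?U" for k y using that by (auto simp: D_scale intro: exI)
      moreover have "lact f y \<in> ?U" if f: "functional scale f" and "y \<in> ?U" for f y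
      proof -
        interpret Vector_Spaces.linear scale scale "lact f" by (rule linear_lact[OF f])
        have "D n (lact f y) = lact f (D n y)" for n
          by (induction n) (simp_all add: D_0 D_Suc lact_ract[OF f X])
        from that(2) obtain n where "D n y = 0" by blast
        with \<open>\<And>n. D n (lact f y) = lact f (D n y)\<close> have "D n (lact f y) = 0" by (simp add: zero)
        then show ?thesis by blast
      qed
      ultimately show ?thesis unfolding stable_def subspace_def by blast
    qed
    then have "?U \<subseteq> cyclic x"
      using stable_chain[OF _ stable_cyclic[of x]] cyclic_self[of x] x by blast
    then obtain F where F: "finite F" "?U \<subseteq> span F" using cyclic_finite[of x] by blast
    have inj: "inj c"
    proof (rule injI)
      fix i j assume "c i = c j"
      then show "i = j" using D_c[of i i] D_c[of i j] by (simp split: if_splits)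
    qed
    have "independent (c ` {..card F})"
    proof (rule independent_if_scalars_zero)
      fix k y assume k: "(\<Sum>y\<in>c ` {..card F}. scale (k y) y) = 0" and y: "y \<in> c ` {..card F}"
      obtain m where m: "m \<le> card F" "y = c m" using y by auto
      interpret f: Vector_Spaces.linear scale "(*)" "\<lambda>x. counit (D m x)" by (rule fun_D)
      have "(\<Sum>i\<le>card F. scale (k (c i)) (c i)) = 0"
        using k by (subst (asm) sum.reindex) (auto intro: inj_on_subset[OF inj])
      then have "counit (D m (\<Sum>i\<le>card F. scale (k (c i)) (c i))) = 0" by (simp add: D_zero e.zero)
      then show "k y = 0" using m by (simp add: f.sum f.scale D_c if_distrib sum.delta cong: if_cong)
    qed simp
    moreover have "c ` {..card F} \<subseteq> span F" using F(2) D_c_0 by blast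
    ultimately have "card (c ` {..card F}) \<le> card F" using independent_span_bound[OF F(1)] by blast
    then show False by (simp add: card_image[OF inj_on_subset[OF inj]])
  qed

  define f where "f x = Abs_poly_mapping (\<lambda>n. counit (D n x))" for x
  have f: "Poly_Mapping.lookup (f x) n = counit (D n x)" for x n
  proof -
    obtain m where m: "D m x = 0" using nilpotent by blast
    have "counit (D n x) = 0" if "n \<ge> m" for n
      using D_D[of "n - m" m x] m that by (simp add: D_zero e.zero)
    then have "{n. counit (D n x) \<noteq> 0} \<subseteq> {..<m}" by (auto simp: not_le[symmetric])
    then have "finite {n. counit (D n x) \<noteq> 0}" by (rule finite_subset) simp
    then show ?thesis by (simp add: f_def)
  qed
  have lin_f: "Vector_Spaces.linear scale fscale f"
    unfolding Vector_Spaces.linear_iff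
    by (auto intro!: poly_mapping_eqI vector_space_axioms free.vector_space_axioms
        simp: f lookup_add D_add D_scale e.add e.scale)
  interpret f: Vector_Spaces.linear scale fscale f by (rule lin_f)
  \<comment> \<open>The last nonzero iterate of \<open>ract X\<close> at \<open>x\<close> lies in the kernel, where the counit is
    injective.\<close>
  have "x = 0" if "f x = 0" for x
  proof (rule ccontr)
    assume "x \<noteq> 0"
    define n where "n = (LEAST n. D n x = 0)"
    have n: "D n x = 0" unfolding n_def using nilpotent by (rule LeastI_ex)
    with \<open>x \<noteq> 0\<close> obtain m where m: "n = Suc m" by (cases n) (auto simp: D_0)
    have "counit (D m x) = 0" using f[of x m] that by simp
    then have "D m x = 0" using eps[of "D m x"] n by (simp add: m D_Suc)
    then have "n \<le> m" unfolding n_def by (rule Least_le)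
    then show False using m by simp
  qed
  then have "inj f" by (metis f.diff injI right_minus_eq)
  moreover have "surj f"
  proof (rule surjI)
    fix p
    have "f (c n) = basis_vec n" for n
      by (rule poly_mapping_eqI) (simp add: f D_c lookup_basis_vec)
    then show "f (linext scale c p) = p"
      by (simp add: linear_comp_linext[OF lin_f] linext_basis_vec_self)
  qed
  moreover have "dp_comult (f a) = tensor_map fscale f (comult a)" for a
  proof -
    have eq: "tensor_class fscale (push (map_prod f f) t) = dp_comult (f a)" if t: "t \<in> comult a" for t
      unfolding dp_comult_def
    proof (rule tensor_class_eqI_coords)
      fix i j
      let ?\<phi> = "\<lambda>(x :: nat \<Rightarrow>\<^sub>0 'k, y :: nat \<Rightarrow>\<^sub>0 'k). Poly_Mapping.lookup x i * Poly_Mapping.lookup y j"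
      have "linext (*) ?\<phi> (push (map_prod f f) t) = linext (*) (\<lambda>(x, y). counit (D j y) * counit (D i x)) t"
        by (simp add: linext_push[OF vector_space_mult] f case_prod_unfold mult.commute)
      also have "\<dots> = counit (D i (linext scale (\<lambda>(x, y). scale (counit (D j y)) x) t))"
        by (simp add: linear_comp_linext[OF fun_D] case_prod_unfold D_scale e.scale)
      also have "\<dots> = counit (D (i + j) a)"
        by (simp add: ract_eq[OF fun_D t, symmetric] ract_D D_D)
      also have "\<dots> = linext (*) ?\<phi> (linext fscale (\<lambda>n. \<Sum>(i, j)\<in>{(i, j). i + j = n}.
           basis_vec (basis_vec i, basis_vec j)) (f a))"
        by (simp only: coords_dp_comult f)
      finally show "linext (*) ?\<phi> (push (map_prod f f) t) = \<dots>" .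
    qed
    then show ?thesis using comult_nonempty[of a] unfolding tensor_map_def by auto
  qed
  moreover have "dp_counit (f a) = counit a" for a
    by (simp add: dp_counit_def linext_coordinate f D_0)
  ultimately show ?thesis
    unfolding coalgebra_iso_def bij_def using lin_f by blast
qed

end

theorem theorem2p9:
  fixes scale :: "'k::alg_closed_field \<Rightarrow> 'c::ab_group_add \<Rightarrow> 'c"
    and comult :: "'c \<Rightarrow> ('c \<times> 'c \<Rightarrow>\<^sub>0 'k) set"
    and counit :: "'c \<Rightarrow> 'k"
  assumes "chain_coalgebra scale comult counit"
    and infinite_dimensional: "\<nexists>B. finite_dimensional_vector_space scale B"
  shows "\<exists>f. coalgebra_iso scale comult counit fscale dp_comult dp_counit f"
proof -
  interpret chain_coalgebra scale comult counit by fact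
  interpret infinite_chain_coalgebra scale comult counit
    by unfold_locales (rule infinite_dimensional)
  show ?thesis by (rule iso_divided_power)
qed

end
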